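(* Let $n\in\mathbb N$, let $F\in GL_n(\mathbb C)$, and let $G\subseteq O^+(F)$ be a compact matrix quantum group with degree of reflection two. Let $S$ be an admissible generating set of the representation category $\mathfrak C_G$ (that is, $\mathfrak C_G=\langle S\rangle_n$ and $S$ is admissible) containing the duality morphism $R\in\mathfrak C_G(0,2)$. Then the category $\mathfrak C_{PG}$ is generated by $$S':=\{\,T,\ \mathrm{id}_{\mathbb C^n}\otimes T\otimes \mathrm{id}_{\mathbb C^n}\mid T\in S\,\},$$ that is, $\mathfrak C_{PG}=\langle S'\rangle_{n^2}$.
   Context: **Quantum groups.** A compact matrix quantum group $G$ of size $n$ (in the sense of Woronowicz, in its algebraic form) is given by its coordinate Hopf $*$-algebra $\mathscr O(G)$ together with its fundamental representation $u=(u^i_j)_{i,j=1}^n\in M_n(\mathscr O(G))$ (upper index = row, lower index = column), whose entries generate $\mathscr O(G)$ as a $*$-algebra; the comultiplication is $\Delta(u^i_j)=\sum_k u^i_k\otimes u^k_j$. Write $\bar u=(u^{i*}_j)_{i,j}$ for the entrywise involution. For $F\in GL_n(\mathbb C)$, the universal orthogonal quantum group $O^+(F)$ has coordinate algebra the universal unital $*$-algebra generated by $u^i_j$, $i,j=1,\dots,n$, subject to the relations that $u$ is unitary and $u=F\bar uF^{-1}$. $G\subseteq O^+(F)$ means that the fundamental representation $u$ of $G$ (of size $n$) satisfies these relations. **Representation category.** For $k,l\in\mathbb N_0$, $$\mathfrak C_G(k,l):=\mathrm{Mor}(u^{\otimes k},u^{\otimes l})=\{T\colon(\mathbb C^n)^{\otimes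 k}\to(\mathbb C^n)^{\otimes l}\text{ linear}\mid Tu^{\otimes k}=u^{\otimes l}T\}.$$ Here $u^{\otimes k}$ has entries $u^{i_1}_{j_1}\cdots u^{i_k}_{j_k}$. The collection $\mathfrak C_G=(\mathfrak C_G(k,l))_{k,l}$ is a concrete rigid monoidal $*$-category with object set $\mathbb N_0$. The duality morphism $R\in\mathfrak C_G(0,2)$ is $R\colon\mathbb C\to\mathbb C^n\otimes\mathbb C^n$ with coordinates $R^{ij}=F_i^j$ (the entry of $F$ in row $j$, column $i$). **Generated categories.** For $N\in\mathbb N$ and a set $S$ of linear maps, each regarded as a map $(\mathbb C^N)^{\otimes k}\to(\mathbb C^N)^{\otimes l}$ for some $k,l$, $\langle S\rangle_N$ denotes the smallest monoidal $*$-category with object set $\mathbb N_0$ and morphism spaces $\mathfrak C(k,l)\subseteq\mathscr L((\mathbb C^N)^{\otimes k},(\mathbb C^N)^{\otimes l})$ containing $S$; that is, the smallest collection of linear subspaces containing $S$ and all identities and closed under tensor products, compositions and adjoints. We identify $\mathbb C^n\otimes\mathbb C^n=\mathbb C^{n^2}$, so a map $(\mathbb C^n)^{\otimes 2k}\to(\mathbb C^n)^{\otimes 2l}$ is also a map $(\mathbb C^{n^2})^{\otimes k}\to(\mathbb C^{n^2})^{\otimes l}$; in $\langle S'\rangle_{n^2}$ the elements of $S'$ are regarded in this latter way. A generating set of $\mathfrak C_G$ is a set $S$ with $\mathfrak C_G=\langle S\rangle_n$. **Degree of reflection two, admissibility.** $G\subseteq O^+(F)$ has degree of reflection two if $\mathfrak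 C_G(k,l)=\{0\}$ whenever $k+l$ is odd. A generating set $S$ of $\mathfrak C_G$ is admissible if it contains only elements of spaces $\mathfrak C_G(k,l)$ with both $k$ and $l$ even. **Projective version.** For $G\subseteq O^+(F)$ with fundamental representation $u$, the projective version $PG$ is the compact matrix quantum group with fundamental representation $v:=u\otimes u$ (of size $n^2$), with entries $v^{ik}_{jl}=u^i_ju^k_l$, and coordinate algebra $\mathscr O(PG)\subseteq\mathscr O(G)$ generated by these entries. Thus $\mathfrak C_{PG}(k,l)=\mathrm{Mor}(v^{\otimes k},v^{\otimes l})=\mathfrak C_G(2k,2l)$. *)

theory Defs
  imports
    Complex_Main
    "Jordan_Normal_Form.Matrix"
    "Jordan_Normal_Form.Schur_Decomposition"
    "Jordan_Normal_Form.Gauss_Jordan_Elimination"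
begin

section \<open>Complex vector spaces and *-algebras\<close>

class complex_vec = ab_group_add +
  fixes scaleC :: "complex \<Rightarrow> 'a \<Rightarrow> 'a" (infixr "*\<^sub>C" 75)
  assumes scaleC_add_right: "c *\<^sub>C (x + y) = c *\<^sub>C x + c *\<^sub>C y"
    and scaleC_add_left: "(c + d) *\<^sub>C x = c *\<^sub>C x + d *\<^sub>C x"
    and scaleC_scaleC: "c *\<^sub>C d *\<^sub>C x = (c * d) *\<^sub>C x"
    and scaleC_one: "1 *\<^sub>C x = x"

lemma scaleC_zero_right: "c *\<^sub>C 0 = (0 :: 'a :: complex_vec)"
proof -
  have "c *\<^sub>C (0 :: 'a) + c *\<^sub>C 0 = c *\<^sub>C 0 + 0"
    by (simp flip: scaleC_add_right)
  then show ?thesis by (simp only: add_left_cancel)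
qed

lemma scaleC_zero_left: "0 *\<^sub>C x = (0 :: 'a :: complex_vec)"
proof -
  have "0 *\<^sub>C x + 0 *\<^sub>C x = 0 *\<^sub>C x + 0"
    by (simp flip: scaleC_add_left)
  then show ?thesis by (simp only: add_left_cancel)
qed

lemma scaleC_minus_left: "(- c) *\<^sub>C x = - (c *\<^sub>C (x :: 'a :: complex_vec))"
  by (rule minus_unique[symmetric]) (simp add: scaleC_zero_left flip: scaleC_add_left)

lemma scaleC_minus_right: "c *\<^sub>C (- x) = - (c *\<^sub>C (x :: 'a :: complex_vec))"
  by (rule minus_unique[symmetric]) (simp add: scaleC_zero_right flip: scaleC_add_right)

text \<open>Unital, associative, not necessarily commutative; the involution is antilinear and
  antimultiplicative.\<close>

class complex_star_algebra = complex_vec + ring + monoid_mult +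
  fixes star :: "'a \<Rightarrow> 'a"
  assumes scaleC_mult_left: "(c *\<^sub>C x) * y = c *\<^sub>C (x * y)"
    and scaleC_mult_right: "x * (c *\<^sub>C y) = c *\<^sub>C (x * y)"
    and star_star: "star (star x) = x"
    and star_add: "star (x + y) = star x + star y"
    and star_scaleC: "star (c *\<^sub>C x) = cnj c *\<^sub>C star x"
    and star_mult: "star (x * y) = star y * star x"

lemma star_one: "star 1 = (1 :: 'a :: complex_star_algebra)"
  by (metis mult_1 mult.right_neutral star_mult star_star)

lemma star_zero: "star 0 = (0 :: 'a :: complex_star_algebra)"
  by (metis add_cancel_right_right star_add)

definition star_subalgebra :: "'a :: complex_star_algebra set \<Rightarrow> bool" where
  "star_subalgebra A \<longleftrightarrow>
     0 \<in> A \<and> 1 \<in> A \<and>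
     (\<forall>x\<in>A. \<forall>y\<in>A. x + y \<in> A \<and> x * y \<in> A) \<and>
     (\<forall>c. \<forall>x\<in>A. c *\<^sub>C x \<in> A) \<and>
     (\<forall>x\<in>A. star x \<in> A)"


section \<open>The algebraic tensor product\<close>

text \<open>A finite list of pairs stands for the formal sum of the elementary tensors
  of its entries; \<open>tensor_eq\<close> is the congruence generated by the usual relations.
  Scalars and signs are absorbed into a tensor factor.\<close>

inductive tensor_eq ::
  "('a :: complex_vec \<times> 'b :: complex_vec) list \<Rightarrow> ('a \<times> 'b) list \<Rightarrow> bool" where
  refl: "tensor_eq xs xs"
| sym: "tensor_eq xs ys \<Longrightarrow> tensor_eq ys xs"
| trans: "tensor_eq xs ys \<Longrightarrow> tensor_eq ys zs \<Longrightarrow> tensor_eq xs zs"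
| append: "tensor_eq xs xs' \<Longrightarrow> tensor_eq ys ys' \<Longrightarrow> tensor_eq (xs @ ys) (xs' @ ys')"
| commute: "tensor_eq (xs @ ys) (ys @ xs)"
| add_left: "tensor_eq [(x + x', y)] [(x, y), (x', y)]"
| add_right: "tensor_eq [(x, y + y')] [(x, y), (x, y')]"
| scale: "tensor_eq [(c *\<^sub>C x, y)] [(x, c *\<^sub>C y)]"
| zero: "tensor_eq [(0, y)] []"

quotient_type (overloaded) ('a, 'b) tensor =
  "('a :: complex_vec \<times> 'b :: complex_vec) list" / tensor_eq
  by (rule equivpI) (auto intro: reflpI sympI transpI tensor_eq.refl tensor_eq.sym
      elim: tensor_eq.trans)

text \<open>Bilinear maps factor through the tensor product.\<close>

lemma tensor_eq_bilinear:
  fixes f :: "'a :: complex_vec \<Rightarrow> 'b :: complex_vec \<Rightarrow> 'c :: complex_vec"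
  assumes "tensor_eq xs ys"
    and "\<And>x x' y. f (x + x') y = f x y + f x' y"
    and "\<And>x y y'. f x (y + y') = f x y + f x y'"
    and "\<And>c x y. f (c *\<^sub>C x) y = c *\<^sub>C f x y"
    and "\<And>c x y. f x (c *\<^sub>C y) = c *\<^sub>C f x y"
  shows "(\<Sum>(x, y)\<leftarrow>xs. f x y) = (\<Sum>(x, y)\<leftarrow>ys. f x y)"
  using assms(1)
proof induction
  case (zero y)
  have "f 0 y = 0"
    using assms(4)[of 0 0 y] by (simp add: scaleC_zero_left)
  then show ?case by simp
qed (auto simp: assms(2-5) add.commute)

text \<open>The same for maps with values in formal sums: this is what makes the operations below
  well defined.\<close>

lemma tensor_eq_concat:
  fixes g :: "'a :: complex_vec \<Rightarrow> 'b :: complex_vec \<Rightarrow>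
      ('c :: complex_vec \<times> 'd :: complex_vec) list"
  assumes "tensor_eq xs ys"
    and "\<And>x x' y. tensor_eq (g (x + x') y) (g x y @ g x' y)"
    and "\<And>x y y'. tensor_eq (g x (y + y')) (g x y @ g x y')"
    and "\<And>c x y. tensor_eq (g (c *\<^sub>C x) y) (g x (c *\<^sub>C y))"
    and "\<And>y. tensor_eq (g 0 y) []"
  shows "tensor_eq (concat (map (\<lambda>(x, y). g x y) xs)) (concat (map (\<lambda>(x, y). g x y) ys))"
  using assms(1)
  by induction (auto simp: assms(2-5) intro: tensor_eq.intros)

lemma tensor_eq_map:
  fixes p :: "'a :: complex_vec \<Rightarrow> 'b :: complex_vec \<Rightarrow> 'c :: complex_vec \<times> 'd :: complex_vec"
  assumes "tensor_eq xs ys"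
    and "\<And>x x' y. tensor_eq [p (x + x') y] [p x y, p x' y]"
    and "\<And>x y y'. tensor_eq [p x (y + y')] [p x y, p x y']"
    and "\<And>c x y. tensor_eq [p (c *\<^sub>C x) y] [p x (c *\<^sub>C y)]"
    and "\<And>y. tensor_eq [p 0 y] []"
  shows "tensor_eq (map (\<lambda>(x, y). p x y) xs) (map (\<lambda>(x, y). p x y) ys)"
  using assms(1) 
proof induction
  case (trans xs ys zs) then show ?case by (blast intro: tensor_eq.trans)
qed (auto simp: assms(2-5) intro: tensor_eq.intros(1,2,4-))

lift_definition pure_tensor ::
  "'a :: complex_vec \<Rightarrow> 'b :: complex_vec \<Rightarrow> ('a, 'b) tensor" (infixr "\<otimes>\<^sub>t" 72)
  is "\<lambda>x y. [(x, y)]" .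

lemma tensor_eq_uminus:
  assumes "tensor_eq xs ys"
  shows "tensor_eq (map (\<lambda>(x, y). (- x, y)) xs) (map (\<lambda>(x, y). (- x, y)) ys)"
proof (rule tensor_eq_map[OF assms])
  show "tensor_eq [(- (c *\<^sub>C x), y)] [(- x, c *\<^sub>C y)]" for c and x :: 'a and y :: 'b
    using tensor_eq.scale[of c "- x" y] by (simp add: scaleC_minus_right)
  show "tensor_eq [(- (x + x'), y)] [(- x, y), (- x', y)]" for x x' :: 'a and y :: 'b
    using tensor_eq.add_left[of "- x" "- x'" y] by (simp add: add.commute)
qed (auto intro: tensor_eq.intros)

lemma tensor_eq_scaleC:
  assumes "tensor_eq xs ys"
  shows "tensor_eq (map (\<lambda>(x, y). (c *\<^sub>C x, y)) xs) (map (\<lambda>(x, y). (c *\<^sub>C x, y)) ys)"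
proof (rule tensor_eq_map[OF assms])
  show "tensor_eq [(c *\<^sub>C d *\<^sub>C x, y)] [(c *\<^sub>C x, d *\<^sub>C y)]" for d and x :: 'a and y :: 'b
    using tensor_eq.scale[of d "c *\<^sub>C x" y] by (simp add: scaleC_scaleC mult.commute)
qed (auto simp: scaleC_add_right scaleC_zero_right intro: tensor_eq.intros)

lemma tensor_eq_cancel: "tensor_eq (map (\<lambda>(x, y). (- x, y)) xs @ xs) []"
proof (induction xs)
  case (Cons a xs)
  obtain x y where a: "a = (x, y)" by force
  let ?m = "map (\<lambda>(x, y). (- x, y))"
  have 1: "tensor_eq ([(- x, y)] @ (?m xs @ [(x, y)]) @ xs)
      ([(- x, y)] @ ([(x, y)] @ ?m xs) @ xs)"
    by (intro tensor_eq.append tensor_eq.refl tensor_eq.commute)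
  have "tensor_eq [(- x, y), (x, y)] [(- x + x, y)]"
    by (rule tensor_eq.sym, rule tensor_eq.add_left)
  then have "tensor_eq [(- x, y), (x, y)] []"
    using tensor_eq.zero[of y] tensor_eq.trans by fastforce
  from tensor_eq.append[OF this Cons.IH] 1 show ?case
    unfolding a by (auto intro: tensor_eq.trans)
qed (auto intro: tensor_eq.refl)

lemma tensor_eq_scaleC_add:
  "tensor_eq (map (\<lambda>(x, y). ((c + d) *\<^sub>C x, y)) xs)
     (map (\<lambda>(x, y). (c *\<^sub>C x, y)) xs @ map (\<lambda>(x, y). (d *\<^sub>C x, y)) xs)"
proof (induction xs)
  case (Cons a xs)
  obtain x y where a: "a = (x, y)" by force
  let ?m = "\<lambda>c. map (\<lambda>(x, y). (c *\<^sub>C x, y))"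
  have "tensor_eq ([((c + d) *\<^sub>C x, y)] @ ?m (c + d) xs)
      ([(c *\<^sub>C x, y), (d *\<^sub>C x, y)] @ (?m c xs @ ?m d xs))"
    by (rule tensor_eq.append[OF _ Cons.IH]) (simp add: scaleC_add_left tensor_eq.add_left)
  moreover have "tensor_eq ([(c *\<^sub>C x, y)] @ ([(d *\<^sub>C x, y)] @ ?m c xs) @ ?m d xs)
      ([(c *\<^sub>C x, y)] @ (?m c xs @ [(d *\<^sub>C x, y)]) @ ?m d xs)"
    by (intro tensor_eq.append tensor_eq.refl tensor_eq.commute)
  ultimately show ?case
    unfolding a by (auto intro: tensor_eq.trans)
qed (auto intro: tensor_eq.refl)

instantiation tensor :: (complex_vec, complex_vec) complex_vec
begin

lift_definition zero_tensor :: "('a, 'b) tensor" is "[]" .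

lift_definition plus_tensor :: "('a, 'b) tensor \<Rightarrow> ('a, 'b) tensor \<Rightarrow> ('a, 'b) tensor"
  is "(@)" by (rule tensor_eq.append)

lift_definition uminus_tensor :: "('a, 'b) tensor \<Rightarrow> ('a, 'b) tensor"
  is "map (\<lambda>(x, y). (- x, y))" by (rule tensor_eq_uminus)

lift_definition scaleC_tensor :: "complex \<Rightarrow> ('a, 'b) tensor \<Rightarrow> ('a, 'b) tensor"
  is "\<lambda>c. map (\<lambda>(x, y). (c *\<^sub>C x, y))" by (rule tensor_eq_scaleC)

definition minus_tensor :: "('a, 'b) tensor \<Rightarrow> ('a, 'b) tensor \<Rightarrow> ('a, 'b) tensor" where
  "minus_tensor s t = s + (- t)"

instance
proof
  fix r s t :: "('a, 'b) tensor" and c d :: complex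
  show "r + s + t = r + (s + t)" by transfer (simp add: tensor_eq.refl)
  show "s + t = t + s" by transfer (rule tensor_eq.commute)
  show "0 + t = t" by transfer (simp add: tensor_eq.refl)
  show "- t + t = 0" by transfer (rule tensor_eq_cancel)
  show "s - t = s + - t" by (rule minus_tensor_def)
  show "c *\<^sub>C (s + t) = c *\<^sub>C s + c *\<^sub>C t" by transfer (simp add: tensor_eq.refl)
  show "(c + d) *\<^sub>C t = c *\<^sub>C t + d *\<^sub>C t" by transfer (rule tensor_eq_scaleC_add)
  show "c *\<^sub>C d *\<^sub>C t = (c * d) *\<^sub>C t"
    by transfer (simp add: case_prod_unfold comp_def scaleC_scaleC tensor_eq.refl)
  show "1 *\<^sub>C t = t"
    by transfer (simp add: case_prod_unfold scaleC_one tensor_eq.refl)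
qed

end

definition tensor_mult_raw ::
  "('a :: complex_star_algebra \<times> 'b :: complex_star_algebra) list \<Rightarrow> ('a \<times> 'b) list \<Rightarrow>
   ('a \<times> 'b) list" where
  "tensor_mult_raw xs ys =
     concat (map (\<lambda>(x, y). map (\<lambda>(x', y'). (x * x', y * y')) ys) xs)"

lemma tensor_mult_raw_right:
  fixes x :: "'a :: complex_star_algebra" and y :: "'b :: complex_star_algebra"
  assumes "tensor_eq ys ys'"
  shows "tensor_eq (map (\<lambda>(x', y'). (x * x', y * y')) ys) (map (\<lambda>(x', y'). (x * x', y * y')) ys')"
  by (rule tensor_eq_map[OF assms])
    (auto simp: distrib_left scaleC_mult_right intro: tensor_eq.intros)

lemma tensor_eq_map_append:
  assumes "\<And>a. a \<in> set zs \<Longrightarrow> tensor_eq [p a] [q a, r a]"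
  shows "tensor_eq (map p zs) (map q zs @ map r zs)"
  using assms
proof (induction zs)
  case (Cons a zs)
  have "tensor_eq ([p a] @ map p zs) ([q a, r a] @ (map q zs @ map r zs))"
    using Cons by (intro tensor_eq.append) auto
  moreover have "tensor_eq ([q a] @ ([r a] @ map q zs) @ map r zs)
      ([q a] @ (map q zs @ [r a]) @ map r zs)"
    by (intro tensor_eq.append tensor_eq.refl tensor_eq.commute)
  ultimately show ?case by (auto intro: tensor_eq.trans)
qed (auto intro: tensor_eq.refl)

lemma tensor_eq_map_cong:
  assumes "\<And>a. a \<in> set zs \<Longrightarrow> tensor_eq [p a] [q a]"
  shows "tensor_eq (map p zs) (map q zs)"
  using assms
proof (induction zs)
  case (Cons a zs)
  then show ?case using tensor_eq.append[of "[p a]" "[q a]" "map p zs" "map q zs"] by simp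
qed (auto intro: tensor_eq.refl)

lemma tensor_eq_map_zero:
  assumes "\<And>a. a \<in> set zs \<Longrightarrow> tensor_eq [p a] []"
  shows "tensor_eq (map p zs) []"
  using assms
proof (induction zs)
  case (Cons a zs)
  then show ?case using tensor_eq.append[of "[p a]" "[]" "map p zs" "[]"] by simp
qed (auto intro: tensor_eq.refl)

lemma tensor_mult_raw_cong:
  assumes "tensor_eq xs xs'" and "tensor_eq ys ys'"
  shows "tensor_eq (tensor_mult_raw xs ys) (tensor_mult_raw xs' ys')"
proof (rule tensor_eq.trans)
  show "tensor_eq (tensor_mult_raw xs ys) (tensor_mult_raw xs' ys)"
    unfolding tensor_mult_raw_def
  proof (rule tensor_eq_concat[OF assms(1)])
    fix x x' :: 'a and y y' :: 'b and c
    show "tensor_eq (map (\<lambda>(z, w). ((x + x') * z, y * w)) ys)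
      (map (\<lambda>(z, w). (x * z, y * w)) ys @ map (\<lambda>(z, w). (x' * z, y * w)) ys)"
      by (rule tensor_eq_map_append) (auto simp: distrib_right intro: tensor_eq.intros)
    show "tensor_eq (map (\<lambda>(z, w). (x * z, (y + y') * w)) ys)
      (map (\<lambda>(z, w). (x * z, y * w)) ys @ map (\<lambda>(z, w). (x * z, y' * w)) ys)"
      by (rule tensor_eq_map_append) (auto simp: distrib_right intro: tensor_eq.intros)
    show "tensor_eq (map (\<lambda>(z, w). ((c *\<^sub>C x) * z, y * w)) ys)
      (map (\<lambda>(z, w). (x * z, (c *\<^sub>C y) * w)) ys)"
      by (rule tensor_eq_map_cong) (auto simp: scaleC_mult_left intro: tensor_eq.intros)
    show "tensor_eq (map (\<lambda>(z, w). (0 * z, y * w)) ys) []"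
      by (rule tensor_eq_map_zero) (auto intro: tensor_eq.intros)
  qed
  show "tensor_eq (tensor_mult_raw xs' ys) (tensor_mult_raw xs' ys')"
    unfolding tensor_mult_raw_def
  proof (induction xs')
    case (Cons a xs')
    then show ?case
      using tensor_mult_raw_right[OF assms(2), of "fst a" "snd a"]
      by (auto simp: case_prod_unfold intro!: tensor_eq.append)
  qed (auto intro: tensor_eq.refl)
qed

lemma tensor_mult_raw_Nil [simp]: "tensor_mult_raw [] zs = []"
  by (simp add: tensor_mult_raw_def)

lemma tensor_mult_raw_Cons:
  "tensor_mult_raw (a # xs) zs = map (\<lambda>b. (fst a * fst b, snd a * snd b)) zs @ tensor_mult_raw xs zs"
  by (simp add: tensor_mult_raw_def case_prod_unfold)

lemma tensor_mult_raw_append: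
  "tensor_mult_raw (xs @ ys) zs = tensor_mult_raw xs zs @ tensor_mult_raw ys zs"
  by (simp add: tensor_mult_raw_def)

lemma tensor_mult_raw_append_right:
  "tensor_eq (tensor_mult_raw zs (xs @ ys)) (tensor_mult_raw zs xs @ tensor_mult_raw zs ys)"
proof (induction zs)
  case (Cons a zs)
  let ?m = "map (\<lambda>b. (fst a * fst b, snd a * snd b))"
  have "tensor_eq (?m (xs @ ys) @ tensor_mult_raw zs (xs @ ys))
     (?m (xs @ ys) @ (tensor_mult_raw zs xs @ tensor_mult_raw zs ys))"
    by (intro tensor_eq.append tensor_eq.refl Cons.IH)
  moreover have "tensor_eq
     (?m xs @ (?m ys @ tensor_mult_raw zs xs) @ tensor_mult_raw zs ys)
     (?m xs @ (tensor_mult_raw zs xs @ ?m ys) @ tensor_mult_raw zs ys)"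
    by (intro tensor_eq.append tensor_eq.refl tensor_eq.commute)
  ultimately show ?case
    unfolding tensor_mult_raw_Cons by (auto intro: tensor_eq.trans)
qed (auto intro: tensor_eq.refl)

lemma tensor_mult_raw_map:
  "tensor_mult_raw (map (\<lambda>b. (x * fst b, y * snd b)) ys) zs =
   map (\<lambda>b. (x * fst b, y * snd b)) (tensor_mult_raw ys zs)"
  by (induction ys) (auto simp: tensor_mult_raw_Cons mult.assoc)

lemma tensor_mult_raw_assoc:
  "tensor_mult_raw (tensor_mult_raw xs ys) zs = tensor_mult_raw xs (tensor_mult_raw ys zs)"
  by (induction xs) (auto simp: tensor_mult_raw_Cons tensor_mult_raw_append tensor_mult_raw_map)

lemma tensor_mult_raw_scaleC_left:
  "tensor_mult_raw (map (\<lambda>(x, y). (c *\<^sub>C x, y)) xs) ys =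
   map (\<lambda>(x, y). (c *\<^sub>C x, y)) (tensor_mult_raw xs ys)"
  by (induction xs) (auto simp: tensor_mult_raw_Cons case_prod_unfold scaleC_mult_left)

lemma tensor_mult_raw_scaleC_right:
  "tensor_mult_raw xs (map (\<lambda>(x, y). (c *\<^sub>C x, y)) ys) =
   map (\<lambda>(x, y). (c *\<^sub>C x, y)) (tensor_mult_raw xs ys)"
  by (induction xs) (auto simp: tensor_mult_raw_Cons case_prod_unfold scaleC_mult_right)

lemma tensor_eq_star:
  assumes "tensor_eq xs ys"
  shows "tensor_eq (map (\<lambda>(x, y). (star x, star y)) xs) (map (\<lambda>(x, y). (star x, star y)) ys)"
  by (rule tensor_eq_map[OF assms])
    (auto simp: star_add star_scaleC star_zero intro: tensor_eq.intros)

lemma tensor_mult_raw_Nil_right [simp]: "tensor_mult_raw zs [] = []"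
  by (induction zs) (auto simp: tensor_mult_raw_Cons)

lemma tensor_mult_raw_single_right:
  "tensor_mult_raw zs [b] = map (\<lambda>a. (fst a * fst b, snd a * snd b)) zs"
  by (induction zs) (auto simp: tensor_mult_raw_Cons)

lemma tensor_mult_raw_star:
  "tensor_eq (map (\<lambda>(x, y). (star x, star y)) (tensor_mult_raw xs ys))
     (tensor_mult_raw (map (\<lambda>(x, y). (star x, star y)) ys) (map (\<lambda>(x, y). (star x, star y)) xs))"
proof (induction xs)
  case (Cons a xs)
  let ?s = "map (\<lambda>(x, y). (star x, star y))"
  have 1: "?s (map (\<lambda>b. (fst a * fst b, snd a * snd b)) ys) =
      tensor_mult_raw (?s ys) [(star (fst a), star (snd a))]"
    by (simp add: tensor_mult_raw_single_right case_prod_unfold comp_def star_mult)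
  have "tensor_eq (?s (tensor_mult_raw (a # xs) ys))
     (tensor_mult_raw (?s ys) [(star (fst a), star (snd a))] @ tensor_mult_raw (?s ys) (?s xs))"
    unfolding tensor_mult_raw_Cons map_append 1
    by (intro tensor_eq.append tensor_eq.refl Cons.IH)
  moreover have "tensor_eq (tensor_mult_raw (?s ys) (?s (a # xs)))
     (tensor_mult_raw (?s ys) [(star (fst a), star (snd a))] @ tensor_mult_raw (?s ys) (?s xs))"
    using tensor_mult_raw_append_right[of "?s ys" "[(star (fst a), star (snd a))]" "?s xs"]
    by (simp add: case_prod_unfold)
  ultimately show ?case by (blast intro: tensor_eq.trans tensor_eq.sym)
qed (auto intro: tensor_eq.refl)

instantiation tensor :: (complex_star_algebra, complex_star_algebra) complex_star_algebra
begin

lift_definition one_tensor :: "('a, 'b) tensor" is "[(1, 1)]" .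

lift_definition times_tensor :: "('a, 'b) tensor \<Rightarrow> ('a, 'b) tensor \<Rightarrow> ('a, 'b) tensor"
  is tensor_mult_raw by (rule tensor_mult_raw_cong)

lift_definition star_tensor :: "('a, 'b) tensor \<Rightarrow> ('a, 'b) tensor"
  is "map (\<lambda>(x, y). (star x, star y))" by (rule tensor_eq_star)

instance
proof
  fix r s t :: "('a, 'b) tensor" and c :: complex
  show "r * s * t = r * (s * t)"
    by transfer (simp add: tensor_mult_raw_assoc tensor_eq.refl)
  show "1 * t = t"
    by transfer (simp add: tensor_mult_raw_Cons tensor_eq.refl)
  show "t * 1 = t"
    by transfer (simp add: tensor_mult_raw_single_right tensor_eq.refl)
  show "(r + s) * t = r * t + s * t"
    by transfer (simp add: tensor_mult_raw_append tensor_eq.refl)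
  show "r * (s + t) = r * s + r * t"
    by transfer (rule tensor_mult_raw_append_right)
  show "(c *\<^sub>C s) * t = c *\<^sub>C (s * t)"
    by transfer (simp add: tensor_mult_raw_scaleC_left tensor_eq.refl)
  show "s * (c *\<^sub>C t) = c *\<^sub>C (s * t)"
    by transfer (simp add: tensor_mult_raw_scaleC_right tensor_eq.refl)
  show "star (star t) = t"
    by transfer (simp add: case_prod_unfold comp_def star_star tensor_eq.refl)
  show "star (s + t) = star s + star t"
    by transfer (simp add: tensor_eq.refl)
  show "star (c *\<^sub>C t) = cnj c *\<^sub>C star t"
    by transfer (simp add: case_prod_unfold comp_def star_scaleC tensor_eq.refl)
  show "star (s * t) = star t * star s"
    by transfer (rule tensor_mult_raw_star)
qed

end

lemma pure_tensor_add_left: "(x + x') \<otimes>\<^sub>t y = x \<otimes>\<^sub>t y + x' \<otimes>\<^sub>t y"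
  by transfer (auto intro: tensor_eq.intros)

lemma pure_tensor_add_right: "x \<otimes>\<^sub>t (y + y') = x \<otimes>\<^sub>t y + x \<otimes>\<^sub>t y'"
  by transfer (auto intro: tensor_eq.intros)

lemma pure_tensor_scaleC_left: "(c *\<^sub>C x) \<otimes>\<^sub>t y = c *\<^sub>C (x \<otimes>\<^sub>t y)"
  by transfer (auto intro: tensor_eq.intros)

lemma pure_tensor_scaleC_right: "x \<otimes>\<^sub>t (c *\<^sub>C y) = c *\<^sub>C (x \<otimes>\<^sub>t y)"
  by transfer (auto intro: tensor_eq.intros)

lemma tensor_eq_snoc:
  assumes "tensor_eq xs ys"
  shows "tensor_eq (map (\<lambda>(x, y). (x, y \<otimes>\<^sub>t z)) xs) (map (\<lambda>(x, y). (x, y \<otimes>\<^sub>t z)) ys)"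
  by (rule tensor_eq_map[OF assms])
    (auto simp: pure_tensor_add_left pure_tensor_scaleC_left intro: tensor_eq.intros)

text \<open>\<open>tensor_snoc t z\<close> is \<open>t \<otimes> z\<close>, moved from \<open>(A \<otimes> B) \<otimes> C\<close> to \<open>A \<otimes> (B \<otimes> C)\<close> along the
  associativity isomorphism.\<close>

lift_definition tensor_snoc ::
  "('a :: complex_vec, 'b :: complex_vec) tensor \<Rightarrow> 'c :: complex_vec \<Rightarrow> ('a, ('b, 'c) tensor) tensor"
  is "\<lambda>xs z. map (\<lambda>(x, y). (x, y \<otimes>\<^sub>t z)) xs"
  by (rule tensor_eq_snoc)


section \<open>Matrices\<close>

text \<open>A linear map from \<open>(\<complex>\<^sup>N)\<^sup>\<otimes>\<^sup>k\<close> to \<open>(\<complex>\<^sup>N)\<^sup>\<otimes>\<^sup>l\<close> is its matrix in the standard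
  basis, with \<open>N ^ l\<close> rows and \<open>N ^ k\<close> columns. The multi-index \<open>(i\<^sub>1, \<dots>, i\<^sub>k)\<close>, each
  \<open>i\<^sub>r < N\<close>, is the number with base-\<open>N\<close> digits \<open>i\<^sub>1 \<dots> i\<^sub>k\<close>, most significant first. In this
  numbering the identification of \<open>\<complex>\<^sup>n \<otimes> \<complex>\<^sup>n\<close> with \<open>\<complex>^(n^2)\<close> does not change any
  matrix.\<close>

definition kron :: "'a :: times mat \<Rightarrow> 'a mat \<Rightarrow> 'a mat" where
  "kron A B = mat (dim_row A * dim_row B) (dim_col A * dim_col B)
     (\<lambda>(i, j). A $$ (i div dim_row B, j div dim_col B) * B $$ (i mod dim_row B, j mod dim_col B))"

fun kron_pow :: "'a :: {zero, one, times} mat \<Rightarrow> nat \<Rightarrow> 'a mat" where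
  "kron_pow A 0 = 1\<^sub>m 1"
| "kron_pow A (Suc k) = kron A (kron_pow A k)"

definition scalar_mat :: "complex mat \<Rightarrow> 'a :: complex_star_algebra mat" where
  "scalar_mat = map_mat (\<lambda>c. c *\<^sub>C 1)"

definition conj_mat :: "'a :: complex_star_algebra mat \<Rightarrow> 'a mat" where
  "conj_mat = map_mat star"

definition unitary_mat :: "nat \<Rightarrow> 'a :: complex_star_algebra mat \<Rightarrow> bool" where
  "unitary_mat n u \<longleftrightarrow> u \<in> carrier_mat n n \<and>
     u * transpose_mat (conj_mat u) = 1\<^sub>m n \<and> transpose_mat (conj_mat u) * u = 1\<^sub>m n"

definition conjugate_by ::
  "complex mat \<Rightarrow> 'a :: complex_star_algebra mat \<Rightarrow> 'a mat" where
  "conjugate_by Q u = scalar_mat Q * u * scalar_mat (the (mat_inverse Q))"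

definition similar_to_unitary :: "nat \<Rightarrow> 'a :: complex_star_algebra mat \<Rightarrow> bool" where
  "similar_to_unitary n u \<longleftrightarrow>
     (\<exists>Q \<in> carrier_mat n n. invertible_mat Q \<and> unitary_mat n (conjugate_by Q u))"


section \<open>Compact matrix quantum groups\<close>

text \<open>The coordinate algebra is a *-subalgebra \<open>A\<close> of an ambient *-algebra (possibly all of it), so
  that a quantum group and its projective version live in the same type. \<open>A \<otimes> A\<close> is the
  subspace of the ambient tensor square consisting of the sums of \<open>x \<otimes> y\<close> with \<open>x, y \<in> A\<close>. The
  structure maps are only constrained on \<open>A\<close>. Maps such as \<open>\<Delta> \<otimes> id\<close> are therefore spelled
  out on the presentations \<open>\<Delta> a = \<Sum> x \<otimes> y\<close> with \<open>x, y \<in> A\<close> (Sweedler notation).\<close>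

definition hopf_star_algebra ::
  "'a :: complex_star_algebra set \<Rightarrow> ('a \<Rightarrow> ('a, 'a) tensor) \<Rightarrow> ('a \<Rightarrow> complex) \<Rightarrow> ('a \<Rightarrow> 'a) \<Rightarrow> bool"
  where
  "hopf_star_algebra A \<Delta> \<epsilon> \<kappa> \<longleftrightarrow>
     star_subalgebra A \<and>
     (\<forall>a\<in>A. \<exists>xs. set xs \<subseteq> A \<times> A \<and> \<Delta> a = (\<Sum>(x, y)\<leftarrow>xs. x \<otimes>\<^sub>t y)) \<and>
     \<Delta> 1 = 1 \<and>
     (\<forall>a\<in>A. \<forall>b\<in>A. \<Delta> (a + b) = \<Delta> a + \<Delta> b \<and> \<Delta> (a * b) = \<Delta> a * \<Delta> b) \<and>
     (\<forall>c. \<forall>a\<in>A. \<Delta> (c *\<^sub>C a) = c *\<^sub>C \<Delta> a) \<and>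
     (\<forall>a\<in>A. \<Delta> (star a) = star (\<Delta> a)) \<and>
     \<epsilon> 1 = 1 \<and>
     (\<forall>a\<in>A. \<forall>b\<in>A. \<epsilon> (a + b) = \<epsilon> a + \<epsilon> b \<and> \<epsilon> (a * b) = \<epsilon> a * \<epsilon> b) \<and>
     (\<forall>c. \<forall>a\<in>A. \<epsilon> (c *\<^sub>C a) = c * \<epsilon> a) \<and>
     (\<forall>a\<in>A. \<epsilon> (star a) = cnj (\<epsilon> a)) \<and>
     (\<forall>a\<in>A. \<kappa> a \<in> A) \<and>
     (\<forall>a\<in>A. \<forall>b\<in>A. \<kappa> (a + b) = \<kappa> a + \<kappa> b) \<and>
     (\<forall>c. \<forall>a\<in>A. \<kappa> (c *\<^sub>C a) = c *\<^sub>C \<kappa> a) \<and>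
     (\<forall>a\<in>A. \<forall>xs. set xs \<subseteq> A \<times> A \<and> \<Delta> a = (\<Sum>(x, y)\<leftarrow>xs. x \<otimes>\<^sub>t y) \<longrightarrow>
        (\<Sum>(x, y)\<leftarrow>xs. tensor_snoc (\<Delta> x) y) = (\<Sum>(x, y)\<leftarrow>xs. x \<otimes>\<^sub>t \<Delta> y) \<and>
        (\<Sum>(x, y)\<leftarrow>xs. \<epsilon> x *\<^sub>C y) = a \<and>
        (\<Sum>(x, y)\<leftarrow>xs. \<epsilon> y *\<^sub>C x) = a \<and>
        (\<Sum>(x, y)\<leftarrow>xs. \<kappa> x * y) = \<epsilon> a *\<^sub>C 1 \<and>
        (\<Sum>(x, y)\<leftarrow>xs. x * \<kappa> y) = \<epsilon> a *\<^sub>C 1)"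

record (overloaded) 'a quantum_group =
  coord :: "'a set"
  comult :: "'a \<Rightarrow> ('a, 'a) tensor"
  counit :: "'a \<Rightarrow> complex"
  antipode :: "'a \<Rightarrow> 'a"
  fund :: "'a mat"

text \<open>In Woronowicz's definition the fundamental representation and its conjugate are, up to
  similarity, unitary; for a quantum subgroup of \<open>O\<^sup>+(F)\<close> this is automatic.\<close>

definition compact_matrix_quantum_group ::
  "nat \<Rightarrow> 'a :: complex_star_algebra quantum_group \<Rightarrow> bool" where
  "compact_matrix_quantum_group n G \<longleftrightarrow>
     hopf_star_algebra (coord G) (comult G) (counit G) (antipode G) \<and>
     fund G \<in> carrier_mat n n \<and>
     coord G = star_subalgebra hull (elements_mat (fund G)) \<and>
     (\<forall>i<n. \<forall>j<n. comult G (fund G $$ (i, j)) =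
        (\<Sum>k<n. fund G $$ (i, k) \<otimes>\<^sub>t fund G $$ (k, j))) \<and>
     similar_to_unitary n (fund G) \<and>
     similar_to_unitary n (conj_mat (fund G))"

text \<open>\<open>G \<subseteq> O\<^sup>+(F)\<close>: the fundamental representation satisfies the defining relations of the
  coordinate algebra of \<open>O\<^sup>+(F)\<close>.\<close>

definition subgroup_of_O_plus ::
  "'a :: complex_star_algebra quantum_group \<Rightarrow> complex mat \<Rightarrow> bool" where
  "subgroup_of_O_plus G F \<longleftrightarrow>
     unitary_mat (dim_row F) (fund G) \<and> fund G = conjugate_by F (conj_mat (fund G))"

definition rep_category ::
  "'a :: complex_star_algebra quantum_group \<Rightarrow> nat \<Rightarrow> nat \<Rightarrow> complex mat set" where
  "rep_category G k l =
     {T \<in> carrier_mat (dim_row (fund G) ^ l) (dim_row (fund G) ^ k).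
        scalar_mat T * kron_pow (fund G) k = kron_pow (fund G) l * scalar_mat T}"

definition degree_of_reflection_two :: "'a :: complex_star_algebra quantum_group \<Rightarrow> bool" where
  "degree_of_reflection_two G \<longleftrightarrow>
     (\<forall>k l. odd (k + l) \<longrightarrow>
        rep_category G k l = {0\<^sub>m (dim_row (fund G) ^ l) (dim_row (fund G) ^ k)})"

definition projective_version ::
  "'a :: complex_star_algebra quantum_group \<Rightarrow> 'a quantum_group" where
  "projective_version G =
     G\<lparr>coord := star_subalgebra hull (elements_mat (kron (fund G) (fund G))),
       fund := kron (fund G) (fund G)\<rparr>"


section \<open>Generated categories\<close>

text \<open>A set of linear maps is a family \<open>S\<close>, where \<open>S k l\<close> holds the members regarded as maps from
  the \<open>k\<close>-th to the \<open>l\<close>-th tensor power.\<close>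

definition monoidal_star_category :: "nat \<Rightarrow> (nat \<Rightarrow> nat \<Rightarrow> complex mat set) \<Rightarrow> bool" where
  "monoidal_star_category N C \<longleftrightarrow>
     (\<forall>k l. C k l \<subseteq> carrier_mat (N ^ l) (N ^ k)) \<and>
     (\<forall>k l. 0\<^sub>m (N ^ l) (N ^ k) \<in> C k l) \<and>
     (\<forall>k l. \<forall>T \<in> C k l. \<forall>T' \<in> C k l. T + T' \<in> C k l) \<and>
     (\<forall>k l c. \<forall>T \<in> C k l. c \<cdot>\<^sub>m T \<in> C k l) \<and>
     (\<forall>k. 1\<^sub>m (N ^ k) \<in> C k k) \<and>
     (\<forall>k l k' l'. \<forall>T \<in> C k l. \<forall>T' \<in> C k' l'. kron T T' \<in> C (k + k') (l + l')) \<and>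
     (\<forall>k l m. \<forall>T \<in> C k l. \<forall>T' \<in> C l m. T' * T \<in> C k m) \<and>
     (\<forall>k l. \<forall>T \<in> C k l. mat_adjoint T \<in> C l k)"

definition generated_category ::
  "nat \<Rightarrow> (nat \<Rightarrow> nat \<Rightarrow> complex mat set) \<Rightarrow> nat \<Rightarrow> nat \<Rightarrow> complex mat set" where
  "generated_category N S k l =
     \<Inter> {C k l | C. monoidal_star_category N C \<and> (\<forall>k l. S k l \<subseteq> C k l)}"

definition admissible :: "(nat \<Rightarrow> nat \<Rightarrow> complex mat set) \<Rightarrow> bool" where
  "admissible S \<longleftrightarrow> (\<forall>k l. S k l \<noteq> {} \<longrightarrow> even k \<and> even l)"

text \<open>\<open>R\<^sup>i\<^sup>j\<close> is the entry of \<open>F\<close> in row \<open>j\<close> and column \<open>i\<close>; \<open>r = i * n + j\<close> encodes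
  \<open>(i, j)\<close>.\<close>

definition duality_morphism :: "complex mat \<Rightarrow> complex mat" where
  "duality_morphism F =
     mat (dim_row F ^ 2) 1 (\<lambda>(r, _). F $$ (r mod dim_row F, r div dim_row F))"

text \<open>For an admissible \<open>S\<close> every member has even degrees, so none is lost by the halving.\<close>

definition projective_generators ::
  "nat \<Rightarrow> (nat \<Rightarrow> nat \<Rightarrow> complex mat set) \<Rightarrow> nat \<Rightarrow> nat \<Rightarrow> complex mat set" where
  "projective_generators n S k l =
     S (2 * k) (2 * l) \<union>
     {kron (1\<^sub>m n) (kron T (1\<^sub>m n)) | T k' l'.
        k = k' + 1 \<and> l = l' + 1 \<and> T \<in> S (2 * k') (2 * l')}"

end

theory Submission
  imports Defs
begin

text \<open>
  Regrouping tensor legs in pairs turns \<open>(u \<otimes> u)\<^sup>\<otimes>\<^sup>k\<close> into \<open>u\<^sup>\<otimes>\<^sup>2\<^sup>k\<close>, so the category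
  of the projective version is the even part of the category of the quantum group
  (\<open>rep_category_projective_version\<close>). What remains concerns generated categories only
  (\<open>generated_category_even_degrees\<close>): if all generators in \<open>S\<close> have even degrees, then the even
  part of the category \<open>\<langle>S\<rangle>\<close> over \<open>\<complex>\<^sup>n\<close> is the category generated over the space
  \<open>\<complex>\<^sup>n \<otimes> \<complex>\<^sup>n\<close> by the maps \<open>T\<close> and \<open>id \<otimes> T \<otimes> id\<close> with \<open>T \<in> S\<close>.

  That the new generators lie in the even part, and that the even part is a category, is immediate.
  For the converse, the interchange law splits a tensor product \<open>T \<otimes> T'\<close> into a composition of
  two padded maps \<open>id \<otimes> T \<otimes> id\<close> (\<open>pad_kron\<close>), so every element of \<open>\<langle>S\<rangle>\<close> should be
  thought of as a combination of composites of padded generators. If the total number of legs is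
  even, then the paddings to the left and to the right of a generator of even degrees have the same
  parity: both are even, and the padded generator is \<open>T\<close> with identities of \<open>\<complex>\<^sup>n \<otimes> \<complex>\<^sup>n\<close> on
  both sides, or both are odd, and it is \<open>id \<otimes> T \<otimes> id\<close> with such identities on both sides.

  To avoid a normal form of composites, the argument is run as an invariant. Let \<open>E\<close> be the
  category over \<open>\<complex>\<^sup>n \<otimes> \<complex>\<^sup>n\<close> generated by the new generators. The maps over \<open>\<complex>\<^sup>n\<close> all of
  whose paddings with an even number of legs belong to \<open>E\<close> form a monoidal *-category
  (\<open>monoidal_star_category_even_padding\<close>) which contains \<open>S\<close>, and hence \<open>\<langle>S\<rangle>\<close>; the empty
  padding then gives the claim.
\<close>

section \<open>Kronecker products\<close>

lemma dim_kron [simp]: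
  "dim_row (kron A B) = dim_row A * dim_row B"
  "dim_col (kron A B) = dim_col A * dim_col B"
  by (simp_all add: kron_def)

lemma index_kron [simp]:
  assumes "i < dim_row A * dim_row B" and "j < dim_col A * dim_col B"
  shows "kron A B $$ (i, j) =
    A $$ (i div dim_row B, j div dim_col B) * B $$ (i mod dim_row B, j mod dim_col B)"
  using assms by (simp add: kron_def)

lemma div_mod_bounds:
  fixes i a b :: nat
  assumes "i < a * b"
  shows "i div b < a" and "i mod b < b"
proof -
  show "i div b < a" using assms by (rule less_mult_imp_div_less)
  show "i mod b < b" using assms by (cases "b = 0") simp_all
qed

lemma kron_assoc:
  fixes A B C :: "'a :: semigroup_mult mat"
  shows "kron (kron A B) C = kron A (kron B C)"
proof (rule eq_matI)
  fix i j
  assume "i < dim_row (kron A (kron B C))" and "j < dim_col (kron A (kron B C))"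
  then have i: "i < dim_row A * dim_row B * dim_row C" and j: "j < dim_col A * dim_col B * dim_col C"
    by (simp_all add: mult.assoc)
  have i': "i < dim_row A * (dim_row B * dim_row C)" and j': "j < dim_col A * (dim_col B * dim_col C)"
    using i j by (simp_all add: mult.assoc)
  have *: "x mod (b * c) div c = x div c mod b" "x mod (b * c) mod c = x mod c"
    "x div (b * c) = x div c div b" if "x < a * b * c" for x a b c :: nat
  proof -
    have "0 < c" using that by (auto intro: gr0I)
    then show "x mod (b * c) div c = x div c mod b"
      by (subst mult.commute[of b c]) (simp add: mod_mult2_eq)
    show "x mod (b * c) mod c = x mod c"
      by (simp add: mod_mod_cancel)
    show "x div (b * c) = x div c div b"
      by (subst mult.commute[of b c]) (simp add: div_mult2_eq)
  qed
  note bounds = div_mod_bounds[OF i] div_mod_bounds[OF j] div_mod_bounds[OF i'] div_mod_bounds[OF j']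
  have "kron (kron A B) C $$ (i, j) =
      A $$ (i div dim_row C div dim_row B, j div dim_col C div dim_col B) *
      B $$ (i div dim_row C mod dim_row B, j div dim_col C mod dim_col B) *
      C $$ (i mod dim_row C, j mod dim_col C)"
    using i j bounds by simp
  moreover have "kron A (kron B C) $$ (i, j) =
      A $$ (i div (dim_row B * dim_row C), j div (dim_col B * dim_col C)) *
      (B $$ (i mod (dim_row B * dim_row C) div dim_row C, j mod (dim_col B * dim_col C) div dim_col C) *
      C $$ (i mod (dim_row B * dim_row C) mod dim_row C, j mod (dim_col B * dim_col C) mod dim_col C))"
    using i' j' bounds by simp
  ultimately show "kron (kron A B) C $$ (i, j) = kron A (kron B C) $$ (i, j)"
    by (simp only: *[OF i] *[OF j] mult.assoc)
qed (simp_all add: mult.assoc)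

lemma sum_div_mod:
  fixes f :: "nat \<Rightarrow> nat \<Rightarrow> 'a :: comm_monoid_add"
  shows "(\<Sum>k<a * b. f (k div b) (k mod b)) = (\<Sum>i<a. \<Sum>j<b. f i j)"
proof -
  have *: "i * b + j < a * b" if "i < a" "j < b" for i j
  proof -
    have "i * b + j < (i + 1) * b" using that by simp
    also have "\<dots> \<le> a * b" using that by (intro mult_right_mono) auto
    finally show ?thesis .
  qed
  have "(\<Sum>k<a * b. f (k div b) (k mod b)) = (\<Sum>(i, j)\<in>{..<a} \<times> {..<b}. f i j)"
    by (rule sum.reindex_bij_witness[where i = "\<lambda>(i, j). i * b + j" and j = "\<lambda>k. (k div b, k mod b)"])
      (auto simp: div_mod_bounds *)
  then show ?thesis by (simp add: sum.cartesian_product)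
qed

lemma kron_mult_kron:
  fixes A B C D :: "'a :: comm_semiring_0 mat"
  assumes "dim_col A = dim_row C" and "dim_col B = dim_row D"
  shows "kron A B * kron C D = kron (A * C) (B * D)"
proof (rule eq_matI)
  fix i j
  assume "i < dim_row (kron (A * C) (B * D))" and "j < dim_col (kron (A * C) (B * D))"
  then have i: "i < dim_row A * dim_row B" and j: "j < dim_col C * dim_col D" by simp_all
  let ?f = "\<lambda>k m. A $$ (i div dim_row B, k) * B $$ (i mod dim_row B, m) *
    (C $$ (k, j div dim_col D) * D $$ (m, j mod dim_col D))"
  have "(kron A B * kron C D) $$ (i, j) =
      (\<Sum>k<dim_row C * dim_row D. ?f (k div dim_row D) (k mod dim_row D))"
    using i j assms by (simp add: scalar_prod_def atLeast0LessThan)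
  also have "\<dots> = (\<Sum>k<dim_row C. \<Sum>m<dim_row D. ?f k m)"
    by (rule sum_div_mod)
  also have "\<dots> = kron (A * C) (B * D) $$ (i, j)"
    using i j assms div_mod_bounds[OF i] div_mod_bounds[OF j]
    by (simp add: scalar_prod_def atLeast0LessThan sum_product ac_simps)
  finally show "(kron A B * kron C D) $$ (i, j) = kron (A * C) (B * D) $$ (i, j)" .
qed simp_all

lemma kron_one_one: "kron (1\<^sub>m a) (1\<^sub>m b :: 'a :: semiring_1 mat) = 1\<^sub>m (a * b)"
proof (rule eq_matI)
  fix i j
  assume "i < dim_row (1\<^sub>m (a * b) :: 'a mat)" and "j < dim_col (1\<^sub>m (a * b) :: 'a mat)"
  then have i: "i < a * b" and j: "j < a * b" by simp_all
  have "i = j \<longleftrightarrow> i div b = j div b \<and> i mod b = j mod b"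
    by (metis div_mult_mod_eq)
  then show "kron (1\<^sub>m a) (1\<^sub>m b) $$ (i, j) = (1\<^sub>m (a * b) :: 'a mat) $$ (i, j)"
    using i j div_mod_bounds[OF i] div_mod_bounds[OF j] by auto
qed simp_all

lemma kron_one_left [simp]: "kron (1\<^sub>m (Suc 0)) (A :: 'a :: semiring_1 mat) = A"
proof (rule eq_matI)
  fix i j
  assume "i < dim_row A" and "j < dim_col A"
  then show "kron (1\<^sub>m (Suc 0)) A $$ (i, j) = A $$ (i, j)" by simp
qed simp_all

lemma kron_one_right [simp]: "kron (A :: 'a :: semiring_1 mat) (1\<^sub>m (Suc 0)) = A"
proof (rule eq_matI)
  fix i j
  assume "i < dim_row A" and "j < dim_col A"
  then show "kron A (1\<^sub>m (Suc 0)) $$ (i, j) = A $$ (i, j)" by simp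
qed simp_all

lemma kron_zero_left [simp]:
  "kron (0\<^sub>m a b) (B :: 'a :: semiring_0 mat) = 0\<^sub>m (a * dim_row B) (b * dim_col B)"
  by (rule eq_matI) (simp_all add: div_mod_bounds)

lemma kron_zero_right [simp]:
  "kron (A :: 'a :: semiring_0 mat) (0\<^sub>m a b) = 0\<^sub>m (dim_row A * a) (dim_col A * b)"
  by (rule eq_matI) (simp_all add: div_mod_bounds)

lemma kron_add_left:
  fixes A B C :: "'a :: semiring mat"
  assumes "dim_row A = dim_row B" and "dim_col A = dim_col B"
  shows "kron (A + B) C = kron A C + kron B C"
  using assms by (intro eq_matI) (simp_all add: div_mod_bounds distrib_right)

lemma kron_add_right:
  fixes A B C :: "'a :: semiring mat"
  assumes "dim_row A = dim_row B" and "dim_col A = dim_col B"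
  shows "kron C (A + B) = kron C A + kron C B"
  using assms by (intro eq_matI) (simp_all add: div_mod_bounds distrib_left)

lemma kron_smult_left: "kron (c \<cdot>\<^sub>m A) (B :: 'a :: comm_semiring_0 mat) = c \<cdot>\<^sub>m kron A B"
  by (rule eq_matI) (simp_all add: div_mod_bounds ac_simps)

lemma kron_smult_right: "kron A (c \<cdot>\<^sub>m B :: 'a :: comm_semiring_0 mat) = c \<cdot>\<^sub>m kron A B"
  by (rule eq_matI) (simp_all add: div_mod_bounds ac_simps)

section \<open>Adjoints\<close>

lemma dim_mat_adjoint [simp]:
  "dim_row (mat_adjoint A) = dim_col A" "dim_col (mat_adjoint A) = dim_row A"
  by (simp_all add: mat_adjoint_def)

lemma index_mat_adjoint [simp]:
  "i < dim_col A \<Longrightarrow> j < dim_row A \<Longrightarrow> mat_adjoint A $$ (i, j) = conjugate (A $$ (j, i))"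
  by (simp add: mat_adjoint_def mat_of_rows_def)

lemma mat_adjoint_kron:
  "mat_adjoint (kron A B) = kron (mat_adjoint A) (mat_adjoint (B :: complex mat))"
  by (rule eq_matI) (simp_all add: div_mod_bounds)

lemma mat_adjoint_one [simp]: "mat_adjoint (1\<^sub>m a) = (1\<^sub>m a :: complex mat)"
  by (rule eq_matI) auto

lemma mat_adjoint_zero [simp]: "mat_adjoint (0\<^sub>m a b) = (0\<^sub>m b a :: complex mat)"
  by (rule eq_matI) auto

section \<open>The category of the projective version\<close>

lemma kron_pow_kron_self:
  fixes u :: "'a :: {zero, monoid_mult} mat"
  shows "kron_pow (kron u u) k = kron_pow u (2 * k)"
  by (induction k) (simp_all add: kron_assoc)

lemma rep_category_projective_version:
  "rep_category (projective_version G) k l = rep_category G (2 * k) (2 * l)"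
  by (simp add: rep_category_def projective_version_def kron_pow_kron_self power_mult power2_eq_square)

section \<open>Monoidal *-categories and generation\<close>

lemma monoidal_star_categoryD:
  assumes "monoidal_star_category N C"
  shows "T \<in> C k l \<Longrightarrow> T \<in> carrier_mat (N ^ l) (N ^ k)"
    and "0\<^sub>m (N ^ l) (N ^ k) \<in> C k l"
    and "T \<in> C k l \<Longrightarrow> T' \<in> C k l \<Longrightarrow> T + T' \<in> C k l"
    and "T \<in> C k l \<Longrightarrow> c \<cdot>\<^sub>m T \<in> C k l"
    and "1\<^sub>m (N ^ k) \<in> C k k"
    and "T \<in> C k l \<Longrightarrow> T' \<in> C k' l' \<Longrightarrow> kron T T' \<in> C (k + k') (l + l')"
    and "T \<in> C k l \<Longrightarrow> T' \<in> C l m \<Longrightarrow> T' * T \<in> C k m"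
    and "T \<in> C k l \<Longrightarrow> mat_adjoint T \<in> C l k"
  proof -
  note C = assms[unfolded monoidal_star_category_def]
  note C1 = C[THEN conjunct1] note C = C[THEN conjunct2]
  note C2 = C[THEN conjunct1] note C = C[THEN conjunct2]
  note C3 = C[THEN conjunct1] note C = C[THEN conjunct2]
  note C4 = C[THEN conjunct1] note C = C[THEN conjunct2]
  note C5 = C[THEN conjunct1] note C = C[THEN conjunct2]
  note C6 = C[THEN conjunct1] note C = C[THEN conjunct2]
  note C7 = C[THEN conjunct1] note C8 = C[THEN conjunct2]
  show "T \<in> C k l \<Longrightarrow> T \<in> carrier_mat (N ^ l) (N ^ k)"
    by (rule C1[rule_format, THEN subsetD])
  show "0\<^sub>m (N ^ l) (N ^ k) \<in> C k l"
    by (rule C2[rule_format])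
  show "T \<in> C k l \<Longrightarrow> T' \<in> C k l \<Longrightarrow> T + T' \<in> C k l"
    by (rule C3[rule_format])
  show "T \<in> C k l \<Longrightarrow> c \<cdot>\<^sub>m T \<in> C k l"
    by (rule C4[rule_format])
  show "1\<^sub>m (N ^ k) \<in> C k k"
    by (rule C5[rule_format])
  show "T \<in> C k l \<Longrightarrow> T' \<in> C k' l' \<Longrightarrow> kron T T' \<in> C (k + k') (l + l')"
    by (rule C6[rule_format])
  show "T \<in> C k l \<Longrightarrow> T' \<in> C l m \<Longrightarrow> T' * T \<in> C k m"
    by (rule C7[rule_format])
  show "T \<in> C k l \<Longrightarrow> mat_adjoint T \<in> C l k"
    by (rule C8[rule_format])
qed

lemma monoidal_star_categoryI:
  assumes "\<And>k l T. T \<in> C k l \<Longrightarrow> T \<in> carrier_mat (N ^ l) (N ^ k)"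
    and "\<And>k l. 0\<^sub>m (N ^ l) (N ^ k) \<in> C k l"
    and "\<And>k l T T'. T \<in> C k l \<Longrightarrow> T' \<in> C k l \<Longrightarrow> T + T' \<in> C k l"
    and "\<And>k l c T. T \<in> C k l \<Longrightarrow> c \<cdot>\<^sub>m T \<in> C k l"
    and "\<And>k. 1\<^sub>m (N ^ k) \<in> C k k"
    and "\<And>k l k' l' T T'. T \<in> C k l \<Longrightarrow> T' \<in> C k' l' \<Longrightarrow> kron T T' \<in> C (k + k') (l + l')"
    and "\<And>k l m T T'. T \<in> C k l \<Longrightarrow> T' \<in> C l m \<Longrightarrow> T' * T \<in> C k m"
    and "\<And>k l T. T \<in> C k l \<Longrightarrow> mat_adjoint T \<in> C l k"
  shows "monoidal_star_category N C"
  unfolding monoidal_star_category_def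
  by (intro conjI allI ballI subsetI) (assumption | rule assms)+

text \<open>A generated category is an intersection over all categories containing the generators. The
  largest category shows that there is at least one of them, so that the morphisms in the
  intersection have the right dimensions.\<close>

lemma monoidal_star_category_all:
  "monoidal_star_category N (\<lambda>k l. carrier_mat (N ^ l) (N ^ k))"
    by (rule monoidal_star_categoryI) (auto simp: power_add)

lemma generated_category_superset: "S k l \<subseteq> generated_category N S k l"
  unfolding generated_category_def by blast

lemma generated_category_least:
  assumes "monoidal_star_category N C" and "\<And>k l. S k l \<subseteq> C k l"
  shows "generated_category N S k l \<subseteq> C k l"
  using assms unfolding generated_category_def by blast

lemma generated_categoryI:
  assumes "\<And>C. monoidal_star_category N C \<Longrightarrow> (\<And>k l. S k l \<subseteq> C k l) \<Longrightarrow> T \<in> C k l"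
  shows "T \<in> generated_category N S k l"
  using assms unfolding generated_category_def by blast

lemma monoidal_star_category_generated:
  assumes "\<And>k l. S k l \<subseteq> carrier_mat (N ^ l) (N ^ k)"
  shows "monoidal_star_category N (generated_category N S)"
proof (rule monoidal_star_categoryI)
  let ?G = "generated_category N S"
  show "T \<in> carrier_mat (N ^ l) (N ^ k)" if "T \<in> ?G k l" for k l T
    using generated_category_least[OF monoidal_star_category_all assms] that by (rule subsetD)
  show "0\<^sub>m (N ^ l) (N ^ k) \<in> ?G k l" for k l
    by (rule generated_categoryI) (rule monoidal_star_categoryD(2))
  show "1\<^sub>m (N ^ k) \<in> ?G k k" for k
    by (rule generated_categoryI) (rule monoidal_star_categoryD(5))
  show "T + T' \<in> ?G k l" if "T \<in> ?G k l" "T' \<in> ?G k l" for k l T T'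
  proof (rule generated_categoryI)
    fix C
    assume C: "monoidal_star_category N C" "\<And>k l. S k l \<subseteq> C k l"
    show "T + T' \<in> C k l"
      using that[THEN generated_category_least[OF C, THEN subsetD]]
      by (rule monoidal_star_categoryD(3)[OF C(1)])
  qed
  show "c \<cdot>\<^sub>m T \<in> ?G k l" if "T \<in> ?G k l" for k l c T
  proof (rule generated_categoryI)
    fix C
    assume C: "monoidal_star_category N C" "\<And>k l. S k l \<subseteq> C k l"
    show "c \<cdot>\<^sub>m T \<in> C k l"
      using that[THEN generated_category_least[OF C, THEN subsetD]]
      by (rule monoidal_star_categoryD(4)[OF C(1)])
  qed
  show "kron T T' \<in> ?G (k + k') (l + l')" if "T \<in> ?G k l" "T' \<in> ?G k' l'" for k l k' l' T T'
  proof (rule generated_categoryI)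
    fix C
    assume C: "monoidal_star_category N C" "\<And>k l. S k l \<subseteq> C k l"
    show "kron T T' \<in> C (k + k') (l + l')"
      using that[THEN generated_category_least[OF C, THEN subsetD]]
      by (rule monoidal_star_categoryD(6)[OF C(1)])
  qed
  show "T' * T \<in> ?G k m" if "T \<in> ?G k l" "T' \<in> ?G l m" for k l m T T'
  proof (rule generated_categoryI)
    fix C
    assume C: "monoidal_star_category N C" "\<And>k l. S k l \<subseteq> C k l"
    show "T' * T \<in> C k m"
      using that[THEN generated_category_least[OF C, THEN subsetD]]
      by (rule monoidal_star_categoryD(7)[OF C(1)])
  qed
  show "mat_adjoint T \<in> ?G l k" if "T \<in> ?G k l" for k l T
  proof (rule generated_categoryI)
    fix C
    assume C: "monoidal_star_category N C" "\<And>k l. S k l \<subseteq> C k l"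
    show "mat_adjoint T \<in> C l k"
      using that[THEN generated_category_least[OF C, THEN subsetD]]
      by (rule monoidal_star_categoryD(8)[OF C(1)])
  qed
qed

lemma monoidal_star_category_even_degrees:
  assumes "monoidal_star_category n C"
  shows "monoidal_star_category (n ^ 2) (\<lambda>k l. C (2 * k) (2 * l))"
proof (rule monoidal_star_categoryI)
  note C = monoidal_star_categoryD[OF assms]
  have pow: "(n ^ 2) ^ k = n ^ (2 * k)" for k by (simp add: power_mult)
  show "0\<^sub>m ((n ^ 2) ^ l) ((n ^ 2) ^ k) \<in> C (2 * k) (2 * l)" for k l
    unfolding pow by (rule C)
  show "1\<^sub>m ((n ^ 2) ^ k) \<in> C (2 * k) (2 * k)" for k
    unfolding pow by (rule C)
  show "T \<in> carrier_mat ((n ^ 2) ^ l) ((n ^ 2) ^ k)" if "T \<in> C (2 * k) (2 * l)" for T k l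
    unfolding pow by (rule C) fact
  show "kron T T' \<in> C (2 * (k + k')) (2 * (l + l'))"
    if "T \<in> C (2 * k) (2 * l)" "T' \<in> C (2 * k') (2 * l')" for T T' k l k' l'
    unfolding distrib_left by (rule C) fact+
  show "T + T' \<in> C (2 * k) (2 * l)"
    if "T \<in> C (2 * k) (2 * l)" "T' \<in> C (2 * k) (2 * l)" for T T' k l
    using that by (rule C)
  show "c \<cdot>\<^sub>m T \<in> C (2 * k) (2 * l)" if "T \<in> C (2 * k) (2 * l)" for c T k l
    using that by (rule C)
  show "T' * T \<in> C (2 * k) (2 * m)"
    if "T \<in> C (2 * k) (2 * l)" "T' \<in> C (2 * l) (2 * m)" for T T' k l m
    using that by (rule C)
  show "mat_adjoint T \<in> C (2 * l) (2 * k)" if "T \<in> C (2 * k) (2 * l)" for T k l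
    using that by (rule C)
qed

section \<open>Padding by identities\<close>

definition pad :: "nat \<Rightarrow> nat \<Rightarrow> nat \<Rightarrow> complex mat \<Rightarrow> complex mat" where
  "pad n a b T = kron (1\<^sub>m (n ^ a)) (kron T (1\<^sub>m (n ^ b)))"

lemma pad_0_0 [simp]: "pad n 0 0 T = T"
  by (simp add: pad_def)

lemma pad_pad: "pad n a b (pad n c d T) = pad n (a + c) (d + b) T"
  by (simp add: pad_def kron_assoc kron_one_one power_add)
     (simp flip: kron_assoc add: kron_one_one)

text \<open>The interchange law, in the form \<open>T \<otimes> T' = (T \<otimes> id) (id \<otimes> T')\<close>: membership of a tensor
  product is reduced to membership of the padded factors.\<close>

lemma pad_kron:
  assumes "T \<in> carrier_mat (n ^ l) (n ^ k)" and "T' \<in> carrier_mat (n ^ l') (n ^ k')"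
  shows "pad n a b (kron T T') = pad n a (l' + b) T * pad n (a + k) b T'"
proof -
  have "pad n a (l' + b) T = kron (1\<^sub>m (n ^ a)) (kron T (kron (1\<^sub>m (n ^ l')) (1\<^sub>m (n ^ b))))"
    by (simp add: pad_def power_add kron_one_one)
  moreover have "pad n (a + k) b T' =
      kron (1\<^sub>m (n ^ a)) (kron (1\<^sub>m (n ^ k)) (kron T' (1\<^sub>m (n ^ b))))"
    by (simp add: pad_def power_add kron_one_one flip: kron_assoc)
  ultimately show ?thesis
    using assms by (simp add: pad_def kron_mult_kron kron_assoc)
qed

text \<open>Quantifying over all paddings, and not only over the empty one and the one by a single leg on
  each side, is what makes the family closed under tensor products; in particular it also
  treats morphisms between odd tensor powers. Where the degrees have different parities, source and
  target of a padding are never both even, so only the zero map is allowed: two such maps could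
  otherwise have a composition or tensor product of even degree without control over it.\<close>

definition even_padding_category ::
  "nat \<Rightarrow> (nat \<Rightarrow> nat \<Rightarrow> complex mat set) \<Rightarrow> nat \<Rightarrow> nat \<Rightarrow> complex mat set" where
  "even_padding_category n E k l =
     {T \<in> carrier_mat (n ^ l) (n ^ k).
        (odd (k + l) \<longrightarrow> T = 0\<^sub>m (n ^ l) (n ^ k)) \<and>
        (\<forall>a b p q. a + k + b = 2 * p \<and> a + l + b = 2 * q \<longrightarrow> pad n a b T \<in> E p q)}"

lemma monoidal_star_category_even_padding:
  assumes "monoidal_star_category (n ^ 2) E"
  shows "monoidal_star_category n (even_padding_category n E)"
proof (rule monoidal_star_categoryI)
  note E = monoidal_star_categoryD[OF assms]
  let ?C = "even_padding_category n E"
  have pow: "n ^ a * (n ^ k * n ^ b) = (n ^ 2) ^ p" if "a + k + b = 2 * p" for a k b p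
  proof -
    have "n ^ a * (n ^ k * n ^ b) = n ^ (a + k + b)" by (simp add: power_add)
    then show ?thesis using that by (simp add: power_mult)
  qed
  show "T \<in> carrier_mat (n ^ l) (n ^ k)" if "T \<in> ?C k l" for T k l
    using that by (simp add: even_padding_category_def)
  show zero: "0\<^sub>m (n ^ l) (n ^ k) \<in> ?C k l" for k l
    by (auto simp: even_padding_category_def pad_def pow E)
  show "T + T' \<in> ?C k l" if "T \<in> ?C k l" "T' \<in> ?C k l" for T T' k l
    using that
    by (auto simp: even_padding_category_def pad_def kron_add_left kron_add_right intro!: E)
  show "c \<cdot>\<^sub>m T \<in> ?C k l" if "T \<in> ?C k l" for c T k l
    using that
    by (auto simp: even_padding_category_def pad_def kron_smult_left kron_smult_right intro!: E)
  show "1\<^sub>m (n ^ k) \<in> ?C k k" for k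
    by (auto simp: even_padding_category_def pad_def kron_one_one pow E)
  show "mat_adjoint T \<in> ?C l k" if "T \<in> ?C k l" for T k l
  proof -
    have "pad n a b (mat_adjoint T) = mat_adjoint (pad n a b T)" for a b
      by (simp add: pad_def mat_adjoint_kron)
    then show ?thesis
      using that by (auto simp: even_padding_category_def add.commute intro!: E)
  qed
  show "T' * T \<in> ?C k m" if T: "T \<in> ?C k l" and T': "T' \<in> ?C l m" for T T' k l m
  proof (cases "even (k + l) \<and> even (l + m)")
    case True
    have dims: "dim_row T = n ^ l" "dim_col T' = n ^ l"
      using T T' by (auto simp: even_padding_category_def)
    have "pad n a b (T' * T) \<in> E p q" if "a + k + b = 2 * p" "a + m + b = 2 * q" for a b p q
    proof -
      (* The intermediate object is even as well, so the composition takes place in E. *)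
      have "even (a + l + b)" using True that by presburger
      then obtain r where "a + l + b = 2 * r" by (rule evenE)
      then have "pad n a b T \<in> E p r" "pad n a b T' \<in> E r q"
        using T T' that by (auto simp: even_padding_category_def)
      then have "pad n a b T' * pad n a b T \<in> E p q" by (rule E)
      then show ?thesis by (simp add: pad_def kron_mult_kron dims)
    qed
    then show ?thesis
      using T T' True by (auto simp: even_padding_category_def)
  next
    case False
    then have "T = 0\<^sub>m (n ^ l) (n ^ k) \<or> T' = 0\<^sub>m (n ^ m) (n ^ l)"
      using T T' by (auto simp: even_padding_category_def)
    moreover have "T \<in> carrier_mat (n ^ l) (n ^ k)" "T' \<in> carrier_mat (n ^ m) (n ^ l)"
      using T T' by (auto simp: even_padding_category_def)
    ultimately have "T' * T = 0\<^sub>m (n ^ m) (n ^ k)" by auto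
    then show ?thesis by (simp add: zero)
  qed
  show "kron T T' \<in> ?C (k + k') (l + l')" if T: "T \<in> ?C k l" and T': "T' \<in> ?C k' l'"
    for T T' k l k' l'
  proof -
    have carrier: "T \<in> carrier_mat (n ^ l) (n ^ k)" "T' \<in> carrier_mat (n ^ l') (n ^ k')"
      using T T' by (auto simp: even_padding_category_def)
    show ?thesis
    proof (cases "even (k + l) \<and> even (k' + l')")
      case True
      have "pad n a b (kron T T') \<in> E p q"
        if "a + (k + k') + b = 2 * p" "a + (l + l') + b = 2 * q" for a b p q
      proof -
        have "even (a + k + l' + b)" using True that by presburger
        then obtain r where "a + k + l' + b = 2 * r" by (rule evenE)
        then have "pad n (a + k) b T' \<in> E p r" "pad n a (l' + b) T \<in> E r q"
          using T T' that by (auto simp: even_padding_category_def add.assoc)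
        then show ?thesis unfolding pad_kron[OF carrier] by (rule E)
      qed
      then show ?thesis
        using carrier True by (auto simp: even_padding_category_def power_add)
    next
      case False
      then have "T = 0\<^sub>m (n ^ l) (n ^ k) \<or> T' = 0\<^sub>m (n ^ l') (n ^ k')"
        using T T' by (auto simp: even_padding_category_def)
      then have "kron T T' = 0\<^sub>m (n ^ (l + l')) (n ^ (k + k'))"
        using carrier by (auto simp: power_add)
      then show ?thesis by (simp add: zero)
    qed
  qed
qed

text \<open>An even number of legs is an identity over \<open>\<complex>\<^sup>n \<otimes> \<complex>\<^sup>n\<close>, so such a padding stays inside
  every category over that space.\<close>

lemma pad_even_mem:
  assumes "monoidal_star_category (n ^ 2) E" and "T \<in> E k l"
  shows "pad n (2 * a) (2 * b) T \<in> E (a + k + b) (a + l + b)"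
  using monoidal_star_categoryD(5,6)[OF assms(1)] assms(2)
  unfolding pad_def power_mult add.assoc by blast

section \<open>The even part of a generated category\<close>

theorem generated_category_even_degrees:
  assumes S: "\<And>k l. S k l \<subseteq> carrier_mat (n ^ l) (n ^ k)" and "admissible S"
  shows "generated_category n S (2 * k) (2 * l) =
    generated_category (n ^ 2) (projective_generators n S) k l"
proof
  let ?C = "generated_category n S"
  let ?E = "generated_category (n ^ 2) (projective_generators n S)"
  have C: "monoidal_star_category n ?C"
    using S by (rule monoidal_star_category_generated)
  have gens: "projective_generators n S k l \<subseteq> ?C (2 * k) (2 * l)" for k l
  proof -
    have "kron (1\<^sub>m n) (kron T (1\<^sub>m n)) \<in> ?C (1 + (2 * k' + 1)) (1 + (2 * l' + 1))"
      if "T \<in> S (2 * k') (2 * l')" for T k' l'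
      using that generated_category_superset[of S "2 * k'" "2 * l'" n]
        monoidal_star_categoryD(5)[OF C, of 1]
      by (intro monoidal_star_categoryD(6)[OF C]) auto
    then show ?thesis
      using generated_category_superset[of S "2 * k" "2 * l" n]
      by (auto simp: projective_generators_def)
  qed
  show "?E k l \<subseteq> ?C (2 * k) (2 * l)"
    using monoidal_star_category_even_degrees[OF C] gens by (rule generated_category_least)
  have E: "monoidal_star_category (n ^ 2) ?E"
  proof (rule monoidal_star_category_generated)
    show "projective_generators n S k l \<subseteq> carrier_mat ((n ^ 2) ^ l) ((n ^ 2) ^ k)" for k l
      using gens[of k l] monoidal_star_categoryD(1)[OF C, of _ "2 * k" "2 * l"]
      by (auto simp: power_mult)
  qed
  (* The parity argument: a padding of T with an even number of legs is an even padding
     either of T or of id (x) T (x) id. *)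
  have "S k l \<subseteq> even_padding_category n ?E k l" for k l
  proof
    fix T
    assume T: "T \<in> S k l"
    then have "even k" "even l" using assms(2) by (auto simp: admissible_def)
    then obtain k' l' where kl: "k = 2 * k'" "l = 2 * l'" by (auto elim!: evenE)
    have "pad n a b T \<in> ?E p q" if "a + k + b = 2 * p" "a + l + b = 2 * q" for a b p q
    proof (cases "even a")
      case True
      then have "even b" using that(1) kl by presburger
      then obtain a' b' where ab: "a = 2 * a'" "b = 2 * b'" using True by (auto elim!: evenE)
      have "T \<in> ?E k' l'"
        using T kl generated_category_superset[of "projective_generators n S" k' l' "n ^ 2"]
        by (auto simp: projective_generators_def)
      moreover have "p = a' + k' + b'" "q = a' + l' + b'"
        using that ab kl by linarith+
      ultimately show ?thesis
        unfolding ab using pad_even_mem[OF E] by simp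
    next
      case False
      then have "odd b" using that(1) kl by presburger
      then obtain a' b' where ab: "a = 2 * a' + 1" "b = 2 * b' + 1" using False by (auto elim!: oddE)
      have "pad n 1 1 T \<in> projective_generators n S (k' + 1) (l' + 1)"
        using T kl by (auto simp: projective_generators_def pad_def)
      then have "pad n 1 1 T \<in> ?E (k' + 1) (l' + 1)"
        using generated_category_superset by blast
      then have "pad n (2 * a') (2 * b') (pad n 1 1 T) \<in>
          ?E (a' + (k' + 1) + b') (a' + (l' + 1) + b')"
        by (rule pad_even_mem[OF E])
      moreover have "p = a' + (k' + 1) + b'" "q = a' + (l' + 1) + b'"
        using that ab kl by linarith+
      ultimately show ?thesis
        unfolding ab pad_pad by (simp add: add.commute)
    qed
    moreover have "T \<in> carrier_mat (n ^ l) (n ^ k)" using S T by blast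
    ultimately show "T \<in> even_padding_category n ?E k l"
      using kl by (simp add: even_padding_category_def)
  qed
  from generated_category_least[OF monoidal_star_category_even_padding[OF E] this]
  have *: "?C (2 * k) (2 * l) \<subseteq> even_padding_category n ?E (2 * k) (2 * l)" .
  show "?C (2 * k) (2 * l) \<subseteq> ?E k l"
  proof
    fix T
    assume "T \<in> ?C (2 * k) (2 * l)"
    then have "\<forall>a b p q. a + 2 * k + b = 2 * p \<and> a + 2 * l + b = 2 * q \<longrightarrow> pad n a b T \<in> ?E p q"
      using * unfolding even_padding_category_def by blast
    from this[rule_format, of 0 0 k l] show "T \<in> ?E k l" by simp
  qed
qed

section \<open>The projective version\<close>

theorem theorem2p4:
  fixes n :: nat and F :: "complex mat"
    and G :: "'a :: complex_star_algebra quantum_group"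
    and S :: "nat \<Rightarrow> nat \<Rightarrow> complex mat set"
  assumes "n \<ge> 1"
    and "F \<in> carrier_mat n n" and "invertible_mat F"
    and "compact_matrix_quantum_group n G" and "subgroup_of_O_plus G F"
    and "degree_of_reflection_two G"
    and "rep_category G = generated_category n S"
    and "admissible S"
    and "duality_morphism F \<in> S 0 2"
  shows "rep_category (projective_version G) = generated_category (n ^ 2) (projective_generators n S)"
proof (intro ext)
  fix k l
  have "dim_row (fund G) = n"
    using assms(4) by (auto simp: compact_matrix_quantum_group_def)
  (* The generators are morphisms of G, hence have the right dimensions. *)
  then have "S k l \<subseteq> carrier_mat (n ^ l) (n ^ k)" for k l
    using generated_category_superset[of S k l n] unfolding assms(7)[symmetric]
    by (auto simp: rep_category_def)
  then have "generated_category n S (2 * k) (2 * l) =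
      generated_category (n ^ 2) (projective_generators n S) k l"
    using assms(8) by (rule generated_category_even_degrees)
  then show "rep_category (projective_version G) k l =
      generated_category (n ^ 2) (projective_generators n S) k l"
    by (simp only: rep_category_projective_version assms(7))
qed

end
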